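(* Let $n\geq 3$ be an integer, let $a,b\in\mathbb{R}$, and let $t$ be an indeterminate. Put \[ f_{\mathbf c}(t;x)=x^n+t\,(x^2+ax+b)\in\mathbb{R}(t)[x], \] and let $\Delta(f_{\mathbf c}(t;x))$ denote its discriminant with respect to $x$. Put $m_0=\lfloor (n-3)/2\rfloor$ and $m_1=\lceil (n-3)/2\rceil$, and for integers $n\geq 4$ and $0\le k\le m_0$ put \[ S_k=(n-1)^3\binom{n-k-3}{k}a^4-\frac{n(n-1)\left\{ 5n^2-(6k+23)n+10k+24 \right\}}{n-k-3}\binom{n-k-3}{k}a^2b +4n^2(n-2)\binom{n-k-4}{k}b^2 . \] (1) If $n=3$, then \[ \Delta(f_{\mathbf c}(t;x))=t^2\left\{(a^2-4b)t^2-(4a^3-18ab)t-27b^2\right\}. \] (2) If $n\geq 4$, then \[ \Delta(f_{\mathbf c}(t;x))=(-1)^{m_1}t^{n-1}\left\{(n-2)^{n-2}(a^2-4b)t^2+\gamma_{\mathbf c}\,t-n^nb^{n-1}\right\}, \] where \[ \gamma_{\mathbf c}=\begin{cases}\displaystyle\sum_{k=0}^{m_0}(-1)^{n+k}n^k(n-1)^{n-2k-4}(n-2)^k a^{n-2k-4}b^k S_k, & \text{if } a\neq 0, \text{ or } a=0 \text{ and } n \text{ even},\\[2mm] 0, & \text{if } a=0 \text{ and } n \text{ odd}.\end{cases} \]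
   Context: $\lfloor\cdot\rfloor$ and $\lceil\cdot\rceil$ are the floor and ceiling functions. Binomial coefficient conventions: $\binom{N}{0}=1$ for $N\ge 0$, $\binom{N}{m}=0$ if $0\le N<m$, and $\binom{N}{m}=0$ for $m<0$. Powers of the form $a^0$ are interpreted as $1$ (also when $a=0$). *)

theory Defs
  imports Complex_Main "Subresultants.Resultant_Prelim"
    "HOL-Computational_Algebra.Polynomial_Factorial"
begin

text \<open>The characteristic-zero sort ensures that \<open>pderiv f\<close> has degree \<open>n - 1\<close>, so the
  resultant below is the determinant of the \<open>(2n - 1) \<times> (2n - 1)\<close> Sylvester matrix.\<close>

definition discriminant :: "'a :: field_char_0 poly \<Rightarrow> 'a" where
  "discriminant f =
     (let n = degree f in (-1) ^ (n * (n - 1) div 2) * resultant f (pderiv f) / lead_coeff f)"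

text \<open>The field \<open>\<real>(t)\<close> is \<open>real poly fract\<close>; \<open>cnst\<close> is the embedding of the real constants and
  \<open>tvar\<close> is the indeterminate \<open>t\<close>.\<close>

definition cnst :: "real \<Rightarrow> real poly fract" where
  "cnst c = to_fract [:c:]"

definition tvar :: "real poly fract" where
  "tvar = to_fract [:0, 1:]"

definition f_poly :: "nat \<Rightarrow> real \<Rightarrow> real \<Rightarrow> real poly fract poly" where
  "f_poly n a b = monom 1 n + smult tvar [:cnst b, cnst a, 1:]"

definition m0 :: "nat \<Rightarrow> nat" where
  "m0 n = nat \<lfloor>(real n - 3) / 2\<rfloor>"

definition m1 :: "nat \<Rightarrow> nat" where
  "m1 n = nat \<lceil>(real n - 3) / 2\<rceil>"

text \<open>For \<open>4 \<le> n\<close> and \<open>k \<le> m0 n\<close> the natural-number subtractions \<open>n - k - 3\<close> and \<open>n - k - 4\<close>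
  in the binomial coefficients do not truncate.\<close>

definition S_coeff :: "nat \<Rightarrow> nat \<Rightarrow> real \<Rightarrow> real \<Rightarrow> real" where
  "S_coeff n k a b =
     (real n - 1) ^ 3 * real ((n - k - 3) choose k) * a ^ 4
     - real n * (real n - 1)
         * (5 * real n ^ 2 - (6 * real k + 23) * real n + 10 * real k + 24)
         / (real n - real k - 3) * real ((n - k - 3) choose k) * a ^ 2 * b
     + 4 * real n ^ 2 * (real n - 2) * real ((n - k - 4) choose k) * b ^ 2"

text \<open>The exponent \<open>n - 2k - 4\<close> equals \<open>-1\<close> when \<open>n\<close> is odd and \<open>k = m0 n\<close>, hence the integer
  powers.\<close>

definition gamma_coeff :: "nat \<Rightarrow> real \<Rightarrow> real \<Rightarrow> real" where
  "gamma_coeff n a b =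
     (if a \<noteq> 0 \<or> even n then
        (\<Sum>k = 0..m0 n.
           (-1) ^ (n + k) * real n ^ k * (real n - 1) powi (int n - 2 * int k - 4)
           * (real n - 2) ^ k * a powi (int n - 2 * int k - 4) * b ^ k * S_coeff n k a b)
      else 0)"

end

theory Submission
  imports Defs "Subresultants.Subresultant"
begin

text \<open>Since \<open>n f - x f' = t q\<close> with the quadratic \<open>q = (n - 2) x\<^sup>2 + (n - 1) a x + n b\<close>, the
  discriminant of \<open>f\<close> is up to sign and powers of \<open>n\<close> and \<open>t\<close> the resultant of \<open>f'\<close> and \<open>q\<close>.
  Powers of \<open>x\<close> modulo \<open>q\<close> are linear polynomials whose coefficients are terms of the Lucas
  sequence \<open>U\<close> with parameters \<open>s = - (n - 1) a\<close> and \<open>p = n (n - 2) b\<close>; so \<open>f'\<close> is reduced to a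
  linear polynomial, and its resultant with \<open>q\<close> is a quadratic polynomial in \<open>t\<close> whose constant
  coefficient is evaluated by the Cassini identity for \<open>U\<close>. The sum \<open>\<gamma>\<close> arises by substituting
  the binomial expansion of \<open>U\<close> into the coefficient of \<open>t\<close>.\<close>

section \<open>Lucas sequences\<close>

fun lucasU :: "'a::comm_ring_1 \<Rightarrow> 'a \<Rightarrow> nat \<Rightarrow> 'a" where
  "lucasU s p 0 = 0"
| "lucasU s p (Suc 0) = 1"
| "lucasU s p (Suc (Suc m)) = s * lucasU s p (Suc m) - p * lucasU s p m"

text \<open>If \<alpha> and \<beta> are the roots of \<open>X^2 - s X + p\<close>, then
  \<open>U_(m+1) - \<beta> U_m = \<alpha>^m\<close>, and the left side is the norm of this element.
  In the induction, one step of the recurrence multiplies the form by \<open>p\<close>.\<close>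

lemma lucasU_cassini:
  "lucasU s p (Suc m) ^ 2 - s * lucasU s p (Suc m) * lucasU s p m + p * lucasU s p m ^ 2 = p ^ m"
proof (induction m)
  case 0
  show ?case by simp
next
  case (Suc m)
  have "lucasU s p (Suc (Suc m)) ^ 2 - s * lucasU s p (Suc (Suc m)) * lucasU s p (Suc m)
          + p * lucasU s p (Suc m) ^ 2
      = p * (lucasU s p (Suc m) ^ 2 - s * lucasU s p (Suc m) * lucasU s p m + p * lucasU s p m ^ 2)"
    by (simp add: algebra_simps power2_eq_square)
  then show ?case using Suc.IH by simp
qed

text \<open>Terms with \<open>2 * k > m\<close> have binomial coefficient zero, so any sufficiently
  large \<open>K\<close> serves. This slack lets two consecutive Lucas terms be summed over the same
  range.\<close>

lemma lucasU_explicit: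
  assumes "m \<le> 2 * K + 1"
  shows "lucasU s p (Suc m) = (\<Sum>k\<le>K. (-p) ^ k * s ^ (m - 2 * k) * of_nat ((m - k) choose k))"
  using assms
proof (induction m arbitrary: K rule: induct_nat_012)
  case 0
  show ?case by (cases K) (simp_all add: sum.atMost_Suc_shift del: sum.atMost_Suc)
next
  case 1
  show ?case by (cases K) (simp_all add: sum.atMost_Suc_shift del: sum.atMost_Suc)
next
  case (ge2 m)
  then obtain K' where K: "K = Suc K'" by (cases K) auto
  let ?g = "\<lambda>m k. (-p) ^ k * s ^ (m - 2 * k) * of_nat ((m - k) choose k)"
  have step: "?g (Suc (Suc m)) (Suc k) = s * ?g (Suc m) (Suc k) - p * ?g m k" for k
  proof -
    have pascal: "(Suc m - k) choose Suc k = (m - k choose Suc k) + (m - k choose k)"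
    proof (cases "k \<le> m")
      case True
      then show ?thesis by (simp add: Suc_diff_le)
    next
      case False
      then show ?thesis by simp
    qed
    \<comment> \<open>The truncated exponent matters only for \<open>m < 2 * k + 1\<close>, where
      the binomial coefficient vanishes.\<close>
    have pow: "s * (s ^ (m - Suc (2 * k)) * of_nat (m - k choose Suc k))
        = s ^ (m - 2 * k) * of_nat (m - k choose Suc k)"
    proof (cases "Suc (2 * k) \<le> m")
      case True
      then have "m - 2 * k = Suc (m - Suc (2 * k))" by simp
      then show ?thesis by (simp add: mult_ac)
    next
      case False
      then show ?thesis by (simp add: binomial_eq_0)
    qed
    have "?g (Suc (Suc m)) (Suc k)
        = (-p) * (-p) ^ k * (s ^ (m - 2 * k) * of_nat (m - k choose Suc k))
          - p * ((-p) ^ k * s ^ (m - 2 * k) * of_nat (m - k choose k))"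
      by (simp add: pascal algebra_simps)
    then show ?thesis
      unfolding pow[symmetric] by (simp add: mult_ac)
  qed
  have "lucasU s p (Suc (Suc (Suc m))) = s * (\<Sum>k\<le>K. ?g (Suc m) k) - p * (\<Sum>k\<le>K'. ?g m k)"
    using ge2.IH(1)[of K'] ge2.IH(2)[of K] ge2.prems K by simp
  also have "\<dots> = ?g (Suc (Suc m)) 0 + (\<Sum>k\<le>K'. s * ?g (Suc m) (Suc k) - p * ?g m k)"
    unfolding K sum.atMost_Suc_shift
    by (simp add: sum_subtractf sum_distrib_left algebra_simps)
  also have "\<dots> = (\<Sum>k\<le>K. ?g (Suc (Suc m)) k)"
    unfolding K sum.atMost_Suc_shift step ..
  finally show ?case .
qed

lemma lucasU_0_even: "lucasU 0 p (2 * m) = 0"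
  by (induction m) simp_all

section \<open>Resultants by division with remainder\<close>

lemma resultant_mod:
  fixes F :: "'a::idom poly"
  assumes eq: "F + B * G = H" and FG: "degree G \<le> degree F" and GH: "degree H < degree G"
  shows "resultant F G
    = (-1) ^ (degree F * degree G) * lead_coeff G ^ (degree F - degree H) * resultant G H"
proof (cases "degree H = 0")
  case False
  then show ?thesis
    using BT_lemma_1_12[OF eq FG disjI1[OF GH], of 0] by (simp add: subresultant_resultant)
next
  case True
  then obtain h where H: "H = [:h:]" by (metis degree_eq_zeroE)
  have "degree G = Suc (degree G - 1)" using GH by simp
  then have "h ^ (degree G - 1) * h = h ^ degree G" by (metis power_Suc2)
  then show ?thesis
    using BT_lemma_1_13'[OF eq FG disjI1[OF GH], of 0] GH
    by (simp add: subresultant_resultant H mult_ac)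
qed

lemma resultant_mod_quadratic:
  fixes c0 c1 c2 r0 r1 :: "'a::field"
  assumes eq: "F + B * [:c0, c1, c2:] = [:r0, r1:]" and F: "2 \<le> degree F" and c2: "c2 \<noteq> 0"
  shows "resultant F [:c0, c1, c2:]
    = c2 ^ (degree F - 1) * (c2 * r0 ^ 2 - c1 * r0 * r1 + c0 * r1 ^ 2)"
proof (cases "r1 = 0")
  case True
  obtain d where d: "degree F = Suc d" using F by (cases "degree F") auto
  show ?thesis
    using resultant_mod[OF eq] F c2 True d by (simp add: power2_eq_square)
next
  case False
  let ?e = "c2 * r0 ^ 2 - c1 * r0 * r1 + c0 * r1 ^ 2"
  \<comment> \<open>A second division: the factor is minus the quotient of the quadratic by
    \<open>r1 x + r0\<close>, and the remainder is the value of the quadratic at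
    \<open>- r0 / r1\<close>.\<close>
  have eq2: "[:c0, c1, c2:] + [:- (c1 * r1 - c2 * r0) / r1 ^ 2, - c2 / r1:] * [:r0, r1:] = [:?e / r1 ^ 2:]"
    using False by (simp add: field_simps power2_eq_square)
  have "resultant [:c0, c1, c2:] [:r0, r1:] = ?e"
    using resultant_mod[OF eq2] False c2 by (simp add: power2_eq_square)
  then show ?thesis
    using resultant_mod[OF eq] F c2 False by simp
qed

text \<open>Modulo the quadratic, \<open>y = N x\<close> satisfies \<open>y^2 = s y - N c\<close>,
  hence \<open>y^(m+1) = U_(m+1) y - N c U_m\<close>. Scaling by powers of \<open>N\<close> avoids
  division by the leading coefficient.\<close>

lemma monom_mod_quadratic:
  fixes N s c :: "'a::comm_ring_1"
  shows "[:c, -s, N:] dvd monom (N ^ Suc m) (Suc m)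
    - [:- (N * c * lucasU s (N * c) m), N * lucasU s (N * c) (Suc m):]"
proof (induction m)
  case 0
  show ?case by (simp add: monom_Suc monom_0)
next
  case (Suc m)
  let ?L = "lucasU s (N * c)"
  have "monom (N ^ Suc (Suc m)) (Suc (Suc m))
      - [:- (N * c * ?L (Suc m)), N * ?L (Suc (Suc m)):]
      = [:0, N:] * (monom (N ^ Suc m) (Suc m) - [:- (N * c * ?L m), N * ?L (Suc m):])
        + [:N * ?L (Suc m):] * [:c, -s, N:]"
    by (simp add: monom_Suc algebra_simps smult_monom)
  then show ?case using Suc.IH by (metis dvd_add dvd_mult dvd_triv_right)
qed

section \<open>Discriminants of trinomials in characteristic zero\<close>

lemma
  fixes t a b :: "'a::field_char_0"
  assumes "3 \<le> n"
  defines "f \<equiv> monom 1 n + smult t [:b, a, 1:]"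
  shows degree_trinomial: "degree f = n"
    and lead_coeff_trinomial: "lead_coeff f = 1"
    and pderiv_trinomial: "pderiv f = monom (of_nat n) (n - 1) + smult t [:a, 2:]"
    and degree_pderiv_trinomial: "degree (pderiv f) = n - 1"
proof -
  have "degree (smult t [:b, a, 1:]) \<le> 2" by simp
  then have "degree (smult t [:b, a, 1:]) < degree (monom (1::'a) n)"
    using assms(1) by (simp add: degree_monom_eq)
  then show deg: "degree f = n"
    unfolding f_def by (simp add: degree_add_eq_left degree_monom_eq del: smult_pCons degree_smult_eq)
  show "pderiv f = monom (of_nat n) (n - 1) + smult t [:a, 2:]"
    unfolding f_def by (simp add: pderiv_add pderiv_monom pderiv_smult pderiv_pCons)
  show "degree (pderiv f) = n - 1"
    using deg by (simp add: degree_pderiv)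
  show "lead_coeff f = 1"
    unfolding deg unfolding f_def using assms(1)
    by (simp add: coeff_pCons split: nat.split)
qed

text \<open>For \<open>n = 3\<close> the polynomials \<open>f'\<close> and \<open>q\<close> have the same degree, so \<open>f\<close> is reduced
  modulo \<open>f'\<close> down to a linear polynomial instead.\<close>

lemma discriminant_trinomial_3:
  fixes t a b :: "'a::field_char_0"
  shows "discriminant (monom 1 3 + smult t [:b, a, 1:])
    = t ^ 2 * ((a ^ 2 - 4 * b) * t ^ 2 - (4 * a ^ 3 - 18 * a * b) * t - 27 * b ^ 2)"
proof -
  define f where "f = monom 1 3 + smult t [:b, a, 1:]"
  define r0 r1 where "r0 = t * b - t ^ 2 * a / 9" and "r1 = 2 * t * a / 3 - 2 * t ^ 2 / 9"
  have f: "f = [:t * b, t * a, t, 1:]"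
    by (simp add: f_def monom_altdef numeral_3_eq_3)
  have fd: "pderiv f = [:t * a, 2 * t, 3:]"
    using pderiv_trinomial[of 3 t b a] by (simp add: f_def monom_altdef eval_nat_numeral)
  have deg: "degree f = 3" and lc: "lead_coeff f = 1"
    using degree_trinomial[of 3 t b a] lead_coeff_trinomial[of 3 t b a] by (simp_all add: f_def)
  have "f + [:- (t / 9), - (1 / 3):] * [:t * a, 2 * t, 3:] = [:r0, r1:]"
    by (simp add: f r0_def r1_def power2_eq_square add_divide_distrib mult_ac one_pCons
        del: pCons_one)
  \<comment> \<open>The extra factor 9, together with \<open>3 ^ 2\<close>, clears the denominators
    of \<open>r0\<close> and \<open>r1\<close>.\<close>
  from resultant_mod_quadratic[OF this] have "9 * resultant f (pderiv f)
      = 9 * (3 ^ 2 * (3 * r0 ^ 2 - 2 * t * r0 * r1 + t * a * r1 ^ 2))"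
    by (simp add: deg fd)
  also have "\<dots> = 9 * - (t ^ 2 * ((a ^ 2 - 4 * b) * t ^ 2 - (4 * a ^ 3 - 18 * a * b) * t - 27 * b ^ 2))"
  proof -
    have "9 * r0 = 9 * t * b - t ^ 2 * a" "9 * r1 = 6 * t * a - 2 * t ^ 2"
      by (simp_all add: r0_def r1_def right_diff_distrib mult.assoc)
    moreover have "9 * (3 ^ 2 * (3 * r0 ^ 2 - 2 * t * r0 * r1 + t * a * r1 ^ 2))
        = 3 * (9 * r0) ^ 2 - 2 * t * (9 * r0) * (9 * r1) + t * a * (9 * r1) ^ 2"
      by (simp add: algebra_simps power2_eq_square)
    ultimately show ?thesis
      by (simp only:) (simp add: algebra_simps power2_eq_square power3_eq_cube)
  qed
  finally have "resultant f (pderiv f)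
      = - (t ^ 2 * ((a ^ 2 - 4 * b) * t ^ 2 - (4 * a ^ 3 - 18 * a * b) * t - 27 * b ^ 2))"
    unfolding mult_cancel_left by simp
  then have "discriminant f
      = t ^ 2 * ((a ^ 2 - 4 * b) * t ^ 2 - (4 * a ^ 3 - 18 * a * b) * t - 27 * b ^ 2)"
    unfolding discriminant_def Let_def lc unfolding deg by simp
  then show ?thesis unfolding f_def .
qed

text \<open>Here \<open>m = n - 2\<close> is the leading coefficient of \<open>q\<close>. The bound
  on \<open>m\<close> makes the degree of \<open>q\<close> smaller than that of the derivative, and
  \<open>t \<noteq> 0\<close> keeps the first remainder quadratic.\<close>

lemma discriminant_trinomial:
  fixes t a b :: "'a::field_char_0" and m :: nat
  defines "s \<equiv> - (of_nat (Suc m) * a)" and "p \<equiv> of_nat m * (of_nat (m + 2) * b)"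
  assumes m: "2 \<le> m" and t: "t \<noteq> 0"
  shows "discriminant (monom 1 (m + 2) + smult t [:b, a, 1:])
    = (-1) ^ ((m + 2) * (m + 1) div 2 + 1) * t ^ Suc m
      * (of_nat m ^ m * (a ^ 2 - 4 * b) * t ^ 2
         - (2 * of_nat (m + 2) * a * b * lucasU s p m
            + (4 * of_nat (m + 2) * b - of_nat (Suc m) * a ^ 2) * lucasU s p (Suc m)) * t
         - of_nat (m + 2) ^ (m + 2) * b ^ Suc m)"
proof -
  define N :: 'a where "N = of_nat m"
  define f where "f = monom 1 (m + 2) + smult t [:b, a, 1:]"
  define q where "q = [:(N + 2) * b, - s, N:]"
  define V0 V1 where "V0 = lucasU s p m" and "V1 = lucasU s p (Suc m)"
  define M where "M = N ^ Suc m"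
  define r0 r1 where "r0 = - ((N + 2) * p * V0) + M * t * a"
    and "r1 = (N + 2) * N * V1 + 2 * M * t"
  \<comment> \<open>The negative of the bracket in the claim, which accounts for the
    \<open>+ 1\<close> in the exponent of the sign.\<close>
  define D where "D = (N + 2) ^ (m + 2) * b ^ Suc m
    + (2 * (N + 2) * a * b * V0 + (4 * (N + 2) * b - (N + 1) * a ^ 2) * V1) * t
    - N ^ m * (a ^ 2 - 4 * b) * t ^ 2"
  have N: "N \<noteq> 0" "N + 1 \<noteq> 0" "N + 2 \<noteq> 0"
  proof -
    show "N \<noteq> 0" using m by (simp add: N_def)
    have "N + 1 = of_nat (m + 1)" "N + 2 = of_nat (m + 2)" by (simp_all add: N_def)
    then show "N + 1 \<noteq> 0" "N + 2 \<noteq> 0" by (metis of_nat_eq_0_iff add_is_0 one_neq_zero zero_neq_numeral)+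
  qed
  have p: "p = N * ((N + 2) * b)" and s: "s = - ((N + 1) * a)"
    by (simp_all add: p_def s_def N_def add.commute)
  have M: "M \<noteq> 0" using N by (simp add: M_def)
  have deg_f: "degree f = m + 2" and lc_f: "lead_coeff f = 1"
    and fd: "pderiv f = monom (N + 2) (Suc m) + smult t [:a, 2:]"
    and deg_fd: "degree (pderiv f) = Suc m"
    using degree_trinomial[of "m + 2" t b a] lead_coeff_trinomial[of "m + 2" t b a]
      pderiv_trinomial[of "m + 2" t b a] degree_pderiv_trinomial[of "m + 2" t b a] m
    by (simp_all add: f_def N_def add.commute)
  have deg_q: "degree q = 2" using N by (simp add: q_def)

  have "f + [:0, - (1 / (N + 2)):] * pderiv f = smult (t / (N + 2)) q"
  proof (rule poly_eqI)
    fix i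
    define d where "d = N + 2"
    have N_d: "N = d - 2" and d: "d \<noteq> 0" using N by (simp_all add: d_def)
    show "coeff (f + [:0, - (1 / (N + 2)):] * pderiv f) i = coeff (smult (t / (N + 2)) q) i"
      unfolding fd unfolding f_def q_def s N_d using d
      by (simp add: coeff_pCons field_simps split: nat.split)
  qed
  \<comment> \<open>The sign disappears because \<open>(m + 2) * (m + 1)\<close> is even; the degree
    drops from \<open>m + 2\<close> to 2, which gives the exponent \<open>m\<close>.\<close>
  from resultant_mod[OF this] have "resultant f (pderiv f)
      = (N + 2) ^ m * resultant (pderiv f) (smult (t / (N + 2)) q)"
    using N m t deg_q unfolding deg_f deg_fd
    by (simp add: degree_smult_eq fd coeff_pCons split: nat.split)
  also have "\<dots> = t ^ Suc m / (N + 2) * resultant (pderiv f) q"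
    using N t by (simp add: resultant_smult_right deg_fd power_divide)
  finally have res_f: "resultant f (pderiv f) = t ^ Suc m / (N + 2) * resultant (pderiv f) q" .

  have "q dvd monom M (Suc m) - [:- (p * V0), N * V1:]"
    using monom_mod_quadratic[of "(N + 2) * b" s N m]
    unfolding q_def M_def V0_def V1_def p .
  then obtain B where B: "monom M (Suc m) - [:- (p * V0), N * V1:] = q * B" by (elim dvdE)
  \<comment> \<open>Scaling by \<open>M\<close> permits the division-free reduction of the top
    power; it costs a factor \<open>M ^ 2\<close> in the resultant with the quadratic
    \<open>q\<close>.\<close>
  have "smult M (pderiv f) = smult (N + 2) (monom M (Suc m)) + smult (M * t) [:a, 2:]"
    by (simp add: fd smult_monom mult_ac smult_add_right)
  also have "monom M (Suc m) = q * B + [:- (p * V0), N * V1:]" using B by (simp add: algebra_simps)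
  finally have "smult M (pderiv f) + (- smult (N + 2) B) * q = [:r0, r1:]"
    by (simp add: r0_def r1_def smult_add_right algebra_simps)
  from resultant_mod_quadratic[OF this[unfolded q_def], folded q_def]
  have "resultant (smult M (pderiv f)) q = N ^ m * (N * r0 ^ 2 + s * r0 * r1 + (N + 2) * b * r1 ^ 2)"
    using m M N deg_fd by simp
  then have res_fd: "M ^ 2 * resultant (pderiv f) q
      = N ^ m * (N * r0 ^ 2 + s * r0 * r1 + (N + 2) * b * r1 ^ 2)"
    by (simp add: resultant_smult_left[OF M] deg_q)

  define W P where "W = N ^ m" and "P = ((N + 2) * b) ^ m"
  have MW: "M = N * W" by (simp add: M_def W_def)
  have cassini: "V1 ^ 2 - s * V1 * V0 + p * V0 ^ 2 = W * P"
    using lucasU_cassini[of s p m] by (simp add: V0_def V1_def W_def P_def p power_mult_distrib)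
  have D: "D = (N + 2) * (N + 2) * b * P
      + (2 * (N + 2) * a * b * V0 + (4 * (N + 2) * b - (N + 1) * a ^ 2) * V1) * t
      - W * (a ^ 2 - 4 * b) * t ^ 2"
    by (simp add: D_def W_def P_def power_mult_distrib)
  \<comment> \<open>With the symbolic powers hidden in \<open>W\<close> and \<open>P\<close>, this
    is a polynomial identity once the Cassini defect is added; that defect is zero.\<close>
  have "N * r0 ^ 2 + s * r0 * r1 + (N + 2) * b * r1 ^ 2
      = N ^ 2 * W * (N + 2) * D
        + (N + 2) ^ 3 * N ^ 2 * b * (V1 ^ 2 - s * V1 * V0 + p * V0 ^ 2 - W * P)"
    unfolding D r0_def r1_def MW s p by (simp add: algebra_simps power2_eq_square power3_eq_cube)
  then have "M ^ 2 * resultant (pderiv f) q = W * (N ^ 2 * W * (N + 2) * D)"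
    unfolding res_fd cassini W_def by simp
  then have "M ^ 2 * resultant (pderiv f) q = M ^ 2 * ((N + 2) * D)"
    by (simp add: MW power2_eq_square mult_ac)
  then have "resultant (pderiv f) q = (N + 2) * D" using M by simp
  then have "resultant f (pderiv f) = t ^ Suc m * D"
    unfolding res_f using N by simp
  then have "discriminant f = (-1) ^ ((m + 2) * (m + 1) div 2) * (t ^ Suc m * D)"
    unfolding discriminant_def lc_f unfolding deg_f Let_def by simp
  then show ?thesis
    unfolding f_def D_def N_def V0_def V1_def by (simp add: algebra_simps)
qed

section \<open>The coefficient gamma in terms of Lucas sequences\<close>

text \<open>The quotient in \<open>S\<^sub>k\<close> is removed by \<open>k \<cdot> C(j + 1, k) = (j + 1) \<cdot> (C(j + 1, k) - C(j, k))\<close>, where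
  \<open>j = n - k - 4\<close>; the two remaining binomials are those of two consecutive Lucas terms.\<close>

lemma S_coeff_eq:
  assumes "m = n - 3" "4 \<le> n" "2 * k \<le> m"
  shows "S_coeff n k a b
    = ((real n - 1) ^ 3 * a ^ 4 - real n * (real n - 1) * (4 * real n - 6) * a ^ 2 * b)
        * real ((m - k) choose k)
      + (4 * real n ^ 2 * (real n - 2) * b ^ 2 - real n * (real n - 1) * (real n - 2) * a ^ 2 * b)
        * real ((m - 1 - k) choose k)"
proof -
  define j where "j = m - k - 1"
  have mk: "m - k = Suc j" "m - 1 - k = j" and n: "real n = real j + real k + 4"
    and nk: "n - k - 3 = Suc j" "n - k - 4 = j"
    using assms by (auto simp: j_def)
  have absorb: "real k * real (Suc j choose k) = real (Suc j) * (real (Suc j choose k) - real (j choose k))"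
  proof (cases k)
    case (Suc i)
    have "real (Suc j * (j choose i)) = real ((Suc j choose Suc i) * Suc i)"
      by (simp only: Suc_times_binomial_eq)
    then show ?thesis by (simp add: Suc algebra_simps)
  qed simp
  have "(5 * real n ^ 2 - (6 * real k + 23) * real n + 10 * real k + 24) * real (Suc j choose k)
      = (5 * real n - 8) * (real (Suc j) * real (Suc j choose k)) - (real n - 2) * (real k * real (Suc j choose k))"
    unfolding n by (simp add: algebra_simps power2_eq_square)
  also have "\<dots> = real (Suc j) * ((4 * real n - 6) * real (Suc j choose k) + (real n - 2) * real (j choose k))"
    unfolding absorb by (simp add: algebra_simps)
  finally have "(5 * real n ^ 2 - (6 * real k + 23) * real n + 10 * real k + 24)
      / real (Suc j) * real (Suc j choose k)
    = (4 * real n - 6) * real (Suc j choose k) + (real n - 2) * real (j choose k)"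
    by (simp add: field_simps)
  moreover have "x / d * c = r \<Longrightarrow> u * x / d * c * v * w = u * r * v * w" for x d c r u v w :: real
    by auto
  ultimately have "real n * (real n - 1) * (5 * real n ^ 2 - (6 * real k + 23) * real n + 10 * real k + 24)
      / real (Suc j) * real (Suc j choose k) * a ^ 2 * b
    = real n * (real n - 1) * ((4 * real n - 6) * real (Suc j choose k)
      + (real n - 2) * real (j choose k)) * a ^ 2 * b"
    by blast
  moreover have "real n - real k - 3 = real (Suc j)" using n by simp
  ultimately show ?thesis
    unfolding S_coeff_def nk mk by (simp only:) (simp add: algebra_simps)
qed

text \<open>The right side is the coefficient of \<open>t\<close> in the bracket of
  \<open>discriminant_trinomial\<close>. Splitting \<open>S_coeff\<close> turns the sum into a
  combination of \<open>U_m\<close> and \<open>U_(m-1)\<close>; the recurrence then matches it with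
  the combination of \<open>U_m\<close> and \<open>U_(m+1)\<close>.\<close>

lemma gamma_coeff_eq:
  fixes a b :: real
  assumes n: "n = m + 2" "2 \<le> m"
  defines "s \<equiv> - ((real m + 1) * a)" and "p \<equiv> real m * ((real m + 2) * b)"
  shows "gamma_coeff n a b = - (2 * real n * a * b * lucasU s p m
            + (4 * real n * b - (real n - 1) * a ^ 2) * lucasU s p (Suc m))"
proof -
  obtain l where m: "m = Suc (Suc l)" using n(2) by (metis Suc_le_D numeral_2_eq_2 Suc_le_mono)
  define K where "K = Suc l div 2"
  have K: "m0 n = K" "Suc l \<le> 2 * K + 1" "l \<le> 2 * K + 1"
  proof -
    have "(real n - 3) / 2 = real (Suc l) / real 2" by (simp add: n m)
    then show "m0 n = K" unfolding m0_def K_def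
      by (simp only: floor_divide_of_nat_eq nat_int)
  qed (simp_all add: K_def)
  have rm: "real n = real m + 2" by (simp add: n)
  define A where "A = (real n - 1) ^ 3 * a ^ 4 - real n * (real n - 1) * (4 * real n - 6) * a ^ 2 * b"
  define C where "C = 4 * real n ^ 2 * (real n - 2) * b ^ 2 - real n * (real n - 1) * (real n - 2) * a ^ 2 * b"
  have S: "S_coeff n k a b = A * real ((Suc l - k) choose k) + C * real ((l - k) choose k)"
    if "k \<le> K" for k
    using S_coeff_eq[of "Suc l" n k a b] that by (simp add: n m A_def C_def K_def)
  define e where "e k = int l - 2 * int k" for k
  have gamma: "gamma_coeff n a b = (\<Sum>k\<le>K. (-p) ^ k * s powi e k * S_coeff n k a b)" if "a \<noteq> 0 \<or> even n"
  proof -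
    have "(-1) ^ (n + k) * real n ^ k * (real n - 1) powi (int n - 2 * int k - 4)
           * (real n - 2) ^ k * a powi (int n - 2 * int k - 4) * b ^ k = (-p) ^ k * s powi e k" for k
    proof -
      \<comment> \<open>Since \<open>e k = n - 4 - 2 k\<close> has the parity of \<open>n\<close>,
        the sign \<open>(-1)^n\<close> can be absorbed into the power of \<open>s\<close>, and
        \<open>(-1)^k\<close> into that of \<open>-p\<close>.\<close>
      have "((-1) :: real) ^ n = (-1) powi e k"
        by (simp add: n m e_def power_int_minus_left)
      moreover have "int n - 2 * int k - 4 = e k" by (simp add: n m e_def)
      moreover have "s = (-1) * (real n - 1) * a" "-p = (-1) * real n * (real n - 2) * b"
        by (simp_all add: s_def p_def n algebra_simps)
      ultimately show ?thesis
        by (simp only: power_add power_int_mult_distrib power_mult_distrib mult_ac)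
    qed
    then show ?thesis
      using that unfolding gamma_coeff_def K(1) by (simp add: atMost_atLeast0)
  qed
  \<comment> \<open>The exponents \<open>e k\<close> can be \<open>-1\<close>, so for \<open>a \<noteq> 0\<close> the identity is shown after multiplying by \<open>s\<close>.\<close>
  have closed: "gamma_coeff n a b
      = ((real n - 1) ^ 2 * a ^ 3 - real n * (4 * real n - 6) * a * b) * - lucasU s p m
        + C * lucasU s p (Suc l)"
  proof (cases "a = 0")
    case False
    then have s: "s \<noteq> 0" by (simp add: s_def)
    have "s * ((-p) ^ k * s powi e k * S_coeff n k a b)
      = A * ((-p) ^ k * s ^ (Suc l - 2 * k) * real ((Suc l - k) choose k))
        + C * (s * ((-p) ^ k * s ^ (l - 2 * k) * real ((l - k) choose k)))"
      if k: "k \<le> K" for k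
    proof -
      have "s * s powi e k = s powi (e k + 1)" using s by (simp add: power_int_add)
      also have "e k + 1 = int (Suc l - 2 * k)" using k by (simp add: e_def K_def)
      finally have 1: "s * s powi e k = s ^ (Suc l - 2 * k)" by simp
      have 2: "s * s powi e k * real ((l - k) choose k) = s * s ^ (l - 2 * k) * real ((l - k) choose k)"
      proof (cases "2 * k \<le> l")
        case True
        then show ?thesis unfolding 1 by (simp add: Suc_diff_le)
      next
        case False
        then show ?thesis by (simp add: binomial_eq_0)
      qed
      have "s * ((-p) ^ k * s powi e k * S_coeff n k a b)
          = A * ((-p) ^ k * (s * s powi e k) * real ((Suc l - k) choose k))
            + C * ((-p) ^ k * (s * s powi e k * real ((l - k) choose k)))"
        by (simp add: S[OF k] algebra_simps)
      then show ?thesis unfolding 2 unfolding 1 by (simp only: mult_ac)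
    qed
    then have "s * gamma_coeff n a b = A * lucasU s p m + C * (s * lucasU s p (Suc l))"
      unfolding m lucasU_explicit[OF K(2)] lucasU_explicit[OF K(3)]
      using False by (simp add: gamma sum.distrib sum_distrib_left)
    \<comment> \<open>\<open>A\<close> contains the factor \<open>s\<close>, so the auxiliary factor
      can be cancelled.\<close>
    also have "A = s * - ((real n - 1) ^ 2 * a ^ 3 - real n * (4 * real n - 6) * a * b)"
      unfolding A_def s_def rm by (simp add: algebra_simps eval_nat_numeral)
    finally have "s * gamma_coeff n a b = s * (((real n - 1) ^ 2 * a ^ 3 - real n * (4 * real n - 6) * a * b) * - lucasU s p m
        + C * lucasU s p (Suc l))" by (simp add: algebra_simps)
    then show ?thesis using s by simp
  next
    case True
    then have s: "s = 0" by (simp add: s_def)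
    show ?thesis
    proof (cases "even n")
      case True
      \<comment> \<open>For even \<open>n\<close> no exponent is negative, so the powers of
        \<open>s = 0\<close> are ordinary ones, with \<open>0^0 = 1\<close>.\<close>
      then have k: "2 * k \<le> l" if "k \<le> K" for k
        using that by (auto simp: K_def n m elim!: evenE)
      have "s powi e k = s ^ (l - 2 * k)" if "k \<le> K" for k
      proof -
        have "e k = int (l - 2 * k)" using k[OF that] by (simp add: e_def)
        then show ?thesis by simp
      qed
      moreover have "A = 0" using \<open>a = 0\<close> by (simp add: A_def)
      ultimately have "gamma_coeff n a b
          = (\<Sum>k\<le>K. C * ((-p) ^ k * s ^ (l - 2 * k) * real ((l - k) choose k)))"
        unfolding gamma[OF disjI2[OF True]] by (intro sum.cong) (auto simp: S)
      also have "\<dots> = C * lucasU s p (Suc l)"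
        unfolding lucasU_explicit[OF K(3)] by (simp add: sum_distrib_left)
      finally show ?thesis using \<open>a = 0\<close> by simp
    next
      case False
      \<comment> \<open>For odd \<open>n\<close> the index \<open>Suc l = n - 3\<close> is even, so
        the remaining Lucas term vanishes at \<open>s = 0\<close>, in agreement with the default
        value of \<open>gamma_coeff\<close>.\<close>
      then obtain i where "Suc l = 2 * i" by (metis n(1) m add_2_eq_Suc' even_Suc evenE)
      then show ?thesis using False \<open>a = 0\<close> s lucasU_0_even[of p i] by (simp add: gamma_coeff_def)
    qed
  qed
  have rec: "lucasU s p (Suc m) = s * lucasU s p m - p * lucasU s p (Suc l)" by (simp add: m)
  have "((real m + 1) ^ 2 * a ^ 3 - (real m + 2) * (4 * real m + 2) * a * b) * - V
        + (4 * (real m + 2) ^ 2 * real m * b ^ 2 - (real m + 2) * (real m + 1) * real m * a ^ 2 * b) * U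
      = - (2 * (real m + 2) * a * b * V + (4 * (real m + 2) * b - (real m + 1) * a ^ 2)
          * (- ((real m + 1) * a) * V - real m * ((real m + 2) * b) * U))" for U V
    by (simp add: algebra_simps power2_eq_square power3_eq_cube)
  from this[folded s_def p_def, of "lucasU s p m" "lucasU s p (Suc l)"] show ?thesis
    unfolding closed rec C_def rm by (simp add: add.commute)
qed

section \<open>Transfer to the field of rational functions\<close>

lemma cnst_simps:
  "cnst 0 = 0" "cnst 1 = 1" "cnst (x + y) = cnst x + cnst y" "cnst (x - y) = cnst x - cnst y"
  "cnst (- x) = - cnst x" "cnst (x * y) = cnst x * cnst y"
  unfolding cnst_def by (simp_all flip: to_fract_add to_fract_diff to_fract_mult to_fract_uminus)

lemma cnst_power: "cnst (x ^ k) = cnst x ^ k"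
  by (induction k) (simp_all add: cnst_simps)

lemma cnst_of_nat: "cnst (of_nat k) = of_nat k"
  by (induction k) (simp_all add: cnst_simps)

lemma cnst_numeral: "cnst (numeral k) = numeral k"
  using cnst_of_nat[of "numeral k"] by simp

lemma cnst_lucasU: "cnst (lucasU s p k) = lucasU (cnst s) (cnst p) k"
  by (induction s p k rule: lucasU.induct) (simp_all add: cnst_simps)

text \<open>With \<open>n = m + 2\<close>, \<open>m1 n\<close> is \<open>m div 2\<close>; its parity
  and that of the other exponent depend only on \<open>m\<close> modulo 4.\<close>

lemma m1_sign: "(-1 :: 'a::ring_1) ^ m1 (m + 2) = (-1) ^ ((m + 2) * (m + 1) div 2 + 1)"
proof -
  have "m1 (m + 2) = m div 2"
  proof (cases "even m")
    case True
    then obtain i where "m = 2 * i" ..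
    then show ?thesis by (simp add: m1_def ceiling_eq_iff nat_eq_iff)
  next
    case False
    then obtain i where "m = 2 * i + 1" ..
    then show ?thesis by (simp add: m1_def)
  qed
  moreover have "even (m div 2) \<longleftrightarrow> even ((m + 2) * (m + 1) div 2 + 1)"
  proof (cases "even m")
    case True
    then obtain i where i: "m = 2 * i" ..
    have "(m + 2) * (m + 1) div 2 = (i + 1) * (2 * i + 1)" by (simp add: i)
    then show ?thesis by (simp add: i)
  next
    case False
    then obtain i where i: "m = 2 * i + 1" ..
    have "(m + 2) * (m + 1) = 2 * ((2 * i + 3) * (i + 1))" by (simp add: i algebra_simps)
    then have "(m + 2) * (m + 1) div 2 = (2 * i + 3) * (i + 1)" by (metis nonzero_mult_div_cancel_left zero_neq_numeral)
    then show ?thesis by (simp add: i)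
  qed
  ultimately show ?thesis by (metis minus_one_power_iff)
qed

theorem theorem3:
  fixes n :: nat and a b :: real
  assumes "n \<ge> 3"
  shows "(n = 3 \<longrightarrow>
            discriminant (f_poly n a b) =
              tvar ^ 2 * (cnst (a ^ 2 - 4 * b) * tvar ^ 2
                          - cnst (4 * a ^ 3 - 18 * a * b) * tvar
                          - cnst (27 * b ^ 2))) \<and>
         (n \<ge> 4 \<longrightarrow>
            discriminant (f_poly n a b) =
              (-1) ^ m1 n * tvar ^ (n - 1)
              * (cnst ((real n - 2) ^ (n - 2) * (a ^ 2 - 4 * b)) * tvar ^ 2
                 + cnst (gamma_coeff n a b) * tvar
                 - cnst (real n ^ n * b ^ (n - 1))))"
proof (intro conjI impI)
  assume "n = 3"
  then show "discriminant (f_poly n a b) =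
              tvar ^ 2 * (cnst (a ^ 2 - 4 * b) * tvar ^ 2
                          - cnst (4 * a ^ 3 - 18 * a * b) * tvar
                          - cnst (27 * b ^ 2))"
    unfolding f_poly_def
    by (simp only: discriminant_trinomial_3 cnst_simps cnst_power cnst_numeral)
next
  assume "n \<ge> 4"
  then obtain m where n: "n = m + 2" and m: "2 \<le> m"
    using that[of "n - 2"] by simp
  have t: "tvar \<noteq> 0" by (simp add: tvar_def)
  let ?s = "- (of_nat (Suc m) * cnst a)" and ?p = "of_nat m * (of_nat (m + 2) * cnst b)"
  have s: "?s = cnst (- ((real m + 1) * a))" and p: "?p = cnst (real m * ((real m + 2) * b))"
    by (simp_all add: cnst_simps cnst_of_nat cnst_numeral add.commute)
  have rm: "real n - 2 = real m" "real n - 1 = real (Suc m)" "n - 1 = Suc m" "n - 2 = m"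
    by (simp_all add: n)
  have gamma: "cnst (gamma_coeff n a b) = - (2 * of_nat n * cnst a * cnst b * lucasU ?s ?p m
      + (4 * of_nat n * cnst b - of_nat (Suc m) * cnst a ^ 2) * lucasU ?s ?p (Suc m))"
    unfolding gamma_coeff_eq[OF n m] rm s p unfolding cnst_lucasU[symmetric]
    by (simp only: cnst_simps cnst_power cnst_of_nat cnst_numeral)
  have top: "cnst ((real n - 2) ^ (n - 2) * (a ^ 2 - 4 * b)) = of_nat m ^ m * (cnst a ^ 2 - 4 * cnst b)"
    and bot: "cnst (real n ^ n * b ^ (n - 1)) = of_nat n ^ n * cnst b ^ Suc m"
    unfolding rm by (simp_all only: cnst_simps cnst_power cnst_of_nat cnst_numeral)
  show "discriminant (f_poly n a b) =
              (-1) ^ m1 n * tvar ^ (n - 1)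
              * (cnst ((real n - 2) ^ (n - 2) * (a ^ 2 - 4 * b)) * tvar ^ 2
                 + cnst (gamma_coeff n a b) * tvar
                 - cnst (real n ^ n * b ^ (n - 1)))"
    unfolding f_poly_def gamma top bot unfolding rm unfolding n m1_sign discriminant_trinomial[OF m t]
    by (simp only: mult_minus_left add_uminus_conv_diff)
qed

end
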